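(* Let $f\in K[x_1,x_2]$ be a homogeneous polynomial of degree $d\ge 2$ with zero Hessian. Then $f=(a_1x_1+a_2x_2)^d$ for some $a_1,a_2\in K$.
   Context: $K$ is an algebraically closed field of characteristic zero. A homogeneous polynomial $f\in K[x_1,\ldots,x_n]$ has zero Hessian if $\det\left(\frac{\partial^2 f}{\partial x_i\partial x_j}\right)_{1\le i,j\le n}=0$ as a polynomial. *)

theory Defs
  imports
    "HOL-Analysis.Determinants"
    "HOL-Computational_Algebra.Polynomial"
    "HOL-Library.Poly_Mapping"
begin

text \<open>
  A polynomial over \<open>'a\<close> in the variables indexed by \<open>'v\<close> is a finitely supported map from exponent
  vectors to coefficients. The ring operations, in particular the convolution product, are those of
  \<open>Poly_Mapping\<close>. The two-variable case uses the index type \<open>2\<close>, whose elements are \<open>1\<close> and \<open>2\<close>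
  (where \<open>2 = 0\<close>).
\<close>

type_synonym ('a, 'v) mpoly = "('v \<Rightarrow>\<^sub>0 nat) \<Rightarrow>\<^sub>0 'a"

definition mconst :: "'a::zero \<Rightarrow> ('a, 'v) mpoly" where
  "mconst c = Poly_Mapping.single 0 c"

definition mvar :: "'v \<Rightarrow> ('a::zero_neq_one, 'v) mpoly" where
  "mvar i = Poly_Mapping.single (Poly_Mapping.single i 1) 1"

text \<open>The zero polynomial is homogeneous of every degree.\<close>

definition homogeneous :: "nat \<Rightarrow> ('a::zero, 'v) mpoly \<Rightarrow> bool" where
  "homogeneous d f \<longleftrightarrow>
    (\<forall>m \<in> Poly_Mapping.keys f. (\<Sum>i \<in> Poly_Mapping.keys m. Poly_Mapping.lookup m i) = d)"

text \<open>
  Subtraction of exponent vectors truncates at \<open>0\<close>; this is harmless, since the monomials not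
  involving the variable \<open>i\<close> get the coefficient \<open>0\<close>.
\<close>

definition mpderiv :: "'v \<Rightarrow> ('a::comm_semiring_1, 'v) mpoly \<Rightarrow> ('a, 'v) mpoly" where
  "mpderiv i f = (\<Sum>m \<in> Poly_Mapping.keys f.
    Poly_Mapping.single (m - Poly_Mapping.single i 1)
      (of_nat (Poly_Mapping.lookup m i) * Poly_Mapping.lookup f m))"

definition hessian :: "('a::comm_ring_1, 'v::finite) mpoly \<Rightarrow> ('a, 'v) mpoly ^ 'v ^ 'v" where
  "hessian f = (\<chi> i j. mpderiv i (mpderiv j f))"

definition zero_hessian :: "('a::comm_ring_1, 'v::finite) mpoly \<Rightarrow> bool" where
  "zero_hessian f \<longleftrightarrow> det (hessian f) = 0"

lemma lookup_mpderiv: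
  "Poly_Mapping.lookup (mpderiv i f) m =
    of_nat (Poly_Mapping.lookup m i + 1) * Poly_Mapping.lookup f (m + Poly_Mapping.single i 1)"
proof -
  let ?e = "Poly_Mapping.single i (1::nat)"
  let ?t = "\<lambda>k. of_nat (Poly_Mapping.lookup k i) * Poly_Mapping.lookup f k"
  have sub: "k = m + ?e" if "k - ?e = m" "Poly_Mapping.lookup k i \<noteq> 0" for k
    using that by (auto intro!: poly_mapping_eqI simp: lookup_add lookup_minus lookup_single when_def)
  have "Poly_Mapping.lookup (mpderiv i f) m =
      (\<Sum>k \<in> Poly_Mapping.keys f. (?t k when k - ?e = m))"
    by (simp add: mpderiv_def lookup_sum lookup_single)
  also have "\<dots> = (\<Sum>k \<in> Poly_Mapping.keys f. if k = m + ?e then ?t k else 0)"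
  proof (intro sum.cong refl)
    fix k
    show "(?t k when k - ?e = m) = (if k = m + ?e then ?t k else 0)"
    proof (cases "Poly_Mapping.lookup k i = 0")
      case False
      then have "k - ?e = m \<longleftrightarrow> k = m + ?e"
        using sub by auto
      then show ?thesis
        by (simp add: when_def)
    qed (auto simp: lookup_add)
  qed
  also have "\<dots> = ?t (m + ?e)"
    by (simp add: in_keys_iff)
  finally show ?thesis
    by (simp add: lookup_add)
qed

end

theory Submission imports Defs begin

text \<open>
  A binary form \<open>f\<close> of degree \<open>d\<close> is determined by \<open>p(t) = f(t, 1)\<close>. By Euler's identity the
  Hessian determinant at \<open>(t, 1)\<close> is \<open>(d - 1) (d p p'' - (d - 1) p'\<^sup>2)\<close>, so that
  \<open>d p p'' = (d - 1) p'\<^sup>2\<close>. At a root of \<open>p\<close> of multiplicity \<open>m > 0\<close>, the lowest-order terms give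
  \<open>d m (m - 1) = (d - 1) m\<^sup>2\<close>, that is \<open>m = d\<close>. Since \<open>deg p \<le> d\<close>, either \<open>p\<close> is constant or
  \<open>p = c (t - r)\<^sup>d\<close>; in both cases \<open>p\<close> is the \<open>d\<close>-th power of a polynomial of degree at most one.
\<close>

section \<open>Dehomogenisation at \<open>x\<^sub>2 = 1\<close> as a ring homomorphism\<close>

definition dehom :: "('a::comm_ring_1, 2) mpoly \<Rightarrow> 'a poly" where
  "dehom f = (\<Sum>m \<in> Poly_Mapping.keys f. monom (Poly_Mapping.lookup f m) (Poly_Mapping.lookup m 1))"

text \<open>Supports change under addition; sums over a common larger index set can be compared
  termwise.\<close>

lemma dehom_superset:
  assumes "finite A" "Poly_Mapping.keys f \<subseteq> A"
  shows "dehom f = (\<Sum>m \<in> A. monom (Poly_Mapping.lookup f m) (Poly_Mapping.lookup m 1))"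
  unfolding dehom_def using assms
  by (intro sum.mono_neutral_left) (auto simp: in_keys_iff)

lemma dehom_0 [simp]: "dehom 0 = 0"
  by (simp add: dehom_def)

lemma dehom_single [simp]: "dehom (Poly_Mapping.single m c) = monom c (Poly_Mapping.lookup m 1)"
  by (subst dehom_superset[where A = "{m}"]) auto

lemma dehom_add: "dehom (f + g) = dehom f + dehom g"
proof -
  let ?A = "Poly_Mapping.keys f \<union> Poly_Mapping.keys g"
  have "Poly_Mapping.keys (f + g) \<subseteq> ?A"
    by (rule Poly_Mapping.keys_add)
  then show ?thesis
    by (simp add: dehom_superset[where A = ?A] lookup_add add_monom[symmetric] sum.distrib)
qed

lemma dehom_uminus: "dehom (- f) = - dehom f"
  using dehom_add[of f "- f"] by (simp add: eq_neg_iff_add_eq_0 add.commute)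

lemma dehom_diff: "dehom (f - g) = dehom f - dehom g"
  using dehom_add[of f "- g"] by (simp add: dehom_uminus)

lemma dehom_sum: "dehom (sum F A) = (\<Sum>x\<in>A. dehom (F x))"
  by (induction A rule: infinite_finite_induct) (auto simp: dehom_add)

lemma mpoly_eq_sum_single:
  "f = (\<Sum>m \<in> Poly_Mapping.keys f. Poly_Mapping.single m (Poly_Mapping.lookup f m))"
  by (rule poly_mapping_eqI) (auto simp: lookup_sum lookup_single when_def in_keys_iff)

lemma dehom_mult: "dehom (f * g) = dehom f * dehom g"
proof -
  have "dehom (f * g) = dehom
    ((\<Sum>m \<in> Poly_Mapping.keys f. Poly_Mapping.single m (Poly_Mapping.lookup f m)) *
     (\<Sum>m \<in> Poly_Mapping.keys g. Poly_Mapping.single m (Poly_Mapping.lookup g m)))"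
    by (simp flip: mpoly_eq_sum_single)
  also have "\<dots> = dehom f * dehom g"
    by (simp add: dehom_def[of f] dehom_def[of g] sum_product dehom_sum mult_single mult_monom
        lookup_add)
  finally show ?thesis .
qed

lemma dehom_1 [simp]: "dehom 1 = 1"
  by (simp add: single_one[symmetric] del: single_one)

lemma dehom_power: "dehom (f ^ n) = dehom f ^ n"
  by (induction n) (simp_all add: dehom_mult)

section \<open>Binary forms and their recovery from the dehomogenisation\<close>

lemma homogeneous_2_iff:
  "homogeneous d (f :: ('a::zero, 2) mpoly) \<longleftrightarrow>
    (\<forall>m \<in> Poly_Mapping.keys f. Poly_Mapping.lookup m 1 + Poly_Mapping.lookup m 2 = d)"
proof -
  have "(\<Sum>i \<in> Poly_Mapping.keys m. Poly_Mapping.lookup m i)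
      = Poly_Mapping.lookup m 1 + Poly_Mapping.lookup m 2" for m :: "2 \<Rightarrow>\<^sub>0 nat"
  proof -
    have "(\<Sum>i \<in> Poly_Mapping.keys m. Poly_Mapping.lookup m i)
        = (\<Sum>i \<in> UNIV. Poly_Mapping.lookup m i)"
      by (rule sum.mono_neutral_left) (auto simp: in_keys_iff)
    then show ?thesis
      by (simp add: sum_2)
  qed
  then show ?thesis
    by (simp add: homogeneous_def)
qed

lemma homogeneous_add:
  fixes f g :: "('a::comm_ring_1, 'v) mpoly"
  shows "homogeneous d f \<Longrightarrow> homogeneous d g \<Longrightarrow> homogeneous d (f + g)"
  unfolding homogeneous_def using Poly_Mapping.keys_add[of f g] by blast

lemma homogeneous_mult:
  fixes f g :: "('a::comm_ring_1, 2) mpoly"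
  assumes "homogeneous d f" "homogeneous e g"
  shows "homogeneous (d + e) (f * g)"
  unfolding homogeneous_2_iff
proof
  fix m assume "m \<in> Poly_Mapping.keys (f * g)"
  then obtain a b where "m = a + b" "a \<in> Poly_Mapping.keys f" "b \<in> Poly_Mapping.keys g"
    using keys_mult[of f g] by blast
  moreover from this assms have "Poly_Mapping.lookup a 1 + Poly_Mapping.lookup a 2 = d"
    "Poly_Mapping.lookup b 1 + Poly_Mapping.lookup b 2 = e"
    unfolding homogeneous_2_iff by blast+
  ultimately show "Poly_Mapping.lookup m 1 + Poly_Mapping.lookup m 2 = d + e"
    by (simp add: lookup_add)
qed

lemma homogeneous_1: "homogeneous 0 (1 :: ('a::comm_ring_1, 2) mpoly)"
  by (simp add: homogeneous_2_iff)

lemma homogeneous_power: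
  fixes f :: "('a::comm_ring_1, 2) mpoly"
  assumes "homogeneous d f"
  shows "homogeneous (n * d) (f ^ n)"
  using assms by (induction n) (simp_all add: homogeneous_1 homogeneous_mult)

text \<open>In a form of known degree the exponent of the first variable determines that of the
  second, so setting the latter to 1 merges no two monomials.\<close>

lemma coeff_dehom:
  fixes f :: "('a::comm_ring_1, 2) mpoly"
  assumes "homogeneous d f" "Poly_Mapping.lookup m 1 + Poly_Mapping.lookup m 2 = d"
  shows "coeff (dehom f) (Poly_Mapping.lookup m 1) = Poly_Mapping.lookup f m"
proof -
  have "k = m" if "k \<in> Poly_Mapping.keys f" "Poly_Mapping.lookup k 1 = Poly_Mapping.lookup m 1" for k
  proof (rule poly_mapping_eqI)
    fix i :: 2
    have "Poly_Mapping.lookup k 2 = Poly_Mapping.lookup m 2"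
      using assms that unfolding homogeneous_2_iff by force
    then show "Poly_Mapping.lookup k i = Poly_Mapping.lookup m i"
      using that exhaust_2[of i] by auto
  qed
  then have "coeff (dehom f) (Poly_Mapping.lookup m 1)
      = (\<Sum>k \<in> Poly_Mapping.keys f. if k = m then Poly_Mapping.lookup f k else 0)"
    unfolding dehom_def coeff_sum coeff_monom by (intro sum.cong) auto
  then show ?thesis
    by (simp add: in_keys_iff)
qed

text \<open>Allows an identity between forms of equal degree to be checked in one variable. Off
  degree \<open>d\<close> both coefficients vanish.\<close>

lemma dehom_inject:
  fixes f g :: "('a::comm_ring_1, 2) mpoly"
  assumes "homogeneous d f" "homogeneous d g" "dehom f = dehom g"
  shows "f = g"
proof (rule poly_mapping_eqI)
  fix m
  show "Poly_Mapping.lookup f m = Poly_Mapping.lookup g m"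
  proof (cases "Poly_Mapping.lookup m 1 + Poly_Mapping.lookup m 2 = d")
    case True
    with assms show ?thesis by (metis coeff_dehom)
  next
    case False
    with assms(1,2) show ?thesis
      unfolding homogeneous_2_iff by (metis in_keys_iff)
  qed
qed

lemma degree_dehom_le:
  assumes "homogeneous d f"
  shows "degree (dehom f) \<le> d"
  unfolding dehom_def
proof (rule degree_sum_le)
  fix m assume "m \<in> Poly_Mapping.keys f"
  with assms have "Poly_Mapping.lookup m 1 \<le> d"
    unfolding homogeneous_2_iff by force
  then show "degree (monom (Poly_Mapping.lookup f m) (Poly_Mapping.lookup m 1)) \<le> d"
    by (rule order.trans[OF degree_monom_le])
qed simp

section \<open>Partial derivatives and the differential equation for \<open>dehom f\<close>\<close>

lemma homogeneous_mpderiv: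
  fixes f :: "('a::comm_ring_1, 2) mpoly"
  assumes "homogeneous (Suc d) f"
  shows "homogeneous d (mpderiv i f)"
  unfolding homogeneous_2_iff
proof
  fix m assume "m \<in> Poly_Mapping.keys (mpderiv i f)"
  then have "m + Poly_Mapping.single i 1 \<in> Poly_Mapping.keys f"
    by (auto simp: in_keys_iff lookup_mpderiv)
  with assms have "Poly_Mapping.lookup (m + Poly_Mapping.single i 1) 1
      + Poly_Mapping.lookup (m + Poly_Mapping.single i 1) 2 = Suc d"
    unfolding homogeneous_2_iff by blast
  then show "Poly_Mapping.lookup m 1 + Poly_Mapping.lookup m 2 = d"
    using exhaust_2[of i] by (auto simp: lookup_add lookup_single when_def)
qed

lemma pderiv_sum: "pderiv (sum F A) = (\<Sum>x\<in>A. pderiv (F x))"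
  by (induction A rule: infinite_finite_induct) (auto simp: pderiv_add)

text \<open>Both derivatives act alike on monomials, and both truncate the exponent at 0, where the
  coefficient is 0 anyway.\<close>

lemma dehom_mpderiv_1:
  fixes f :: "('a::{idom, semiring_char_0}, 2) mpoly"
  shows "dehom (mpderiv 1 f) = pderiv (dehom f)"
  by (simp add: mpderiv_def dehom_sum dehom_def[of f] pderiv_sum pderiv_monom lookup_minus)

text \<open>Euler's identity at \<open>x\<^sub>2 = 1\<close>.\<close>

lemma dehom_mpderiv_2:
  fixes f :: "('a::{idom, semiring_char_0}, 2) mpoly"
  assumes "homogeneous d f"
  shows "dehom (mpderiv 2 f) = of_nat d * dehom f - [:0, 1:] * pderiv (dehom f)"
proof -
  \<comment> \<open>Euler's identity for a single monomial: the exponent of the second variable is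
    \<open>d\<close> minus that of the first.\<close>
  have "monom (of_nat (Poly_Mapping.lookup m 2) * c) (Poly_Mapping.lookup m 1)
     = of_nat d * monom c (Poly_Mapping.lookup m 1) - [:0, 1:] * pderiv (monom c (Poly_Mapping.lookup m 1))"
    if "m \<in> Poly_Mapping.keys f" for m and c :: 'a
  proof -
    have "d = Poly_Mapping.lookup m 1 + Poly_Mapping.lookup m 2"
      using assms that by (simp add: homogeneous_2_iff)
    then show ?thesis
      by (intro poly_eqI) (auto simp: pderiv_monom of_nat_poly coeff_pCons algebra_simps split: nat.splits)
  qed
  then show ?thesis
    by (simp add: mpderiv_def dehom_sum dehom_def[of f] pderiv_sum lookup_minus lookup_single
        sum_distrib_left sum_subtractf cong: sum.cong)
qed

text \<open>Euler's identity, applied to \<open>f\<close> and to its first derivatives, expresses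
  all second derivatives through \<open>p\<close>. The terms containing \<open>?t\<close> cancel in
  the determinant.\<close>

lemma zero_hessian_imp_ode:
  fixes f :: "('a::{idom, ring_char_0}, 2) mpoly"
  assumes "homogeneous (Suc e) f" "zero_hessian f" "e \<noteq> 0"
  defines "p \<equiv> dehom f"
  shows "of_nat (Suc e) * p * pderiv (pderiv p) = of_nat e * pderiv p ^ 2"
proof -
  let ?t = "[:0, 1:] :: 'a poly"
  have f2: "dehom (mpderiv 2 f) = of_nat (Suc e) * p - ?t * pderiv p"
    unfolding p_def by (rule dehom_mpderiv_2[OF assms(1)])
  have f1: "dehom (mpderiv 1 f) = pderiv p"
    unfolding p_def by (rule dehom_mpderiv_1)
  have e: "dehom (mpderiv 2 (mpderiv i f))
      = of_nat e * dehom (mpderiv i f) - ?t * pderiv (dehom (mpderiv i f))" for i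
    by (rule dehom_mpderiv_2[OF homogeneous_mpderiv[OF assms(1)]])
  have t: "pderiv ?t = 1" by (simp add: pderiv_pCons)
  have d2: "pderiv (of_nat (Suc e) * p - ?t * pderiv p) = of_nat e * pderiv p - ?t * pderiv (pderiv p)"
    by (simp add: pderiv_diff pderiv_mult pderiv_of_nat t algebra_simps pderiv_add del: mult_pCons_left mult_pCons_right)
  from assms(2) have "dehom (mpderiv 1 (mpderiv 1 f) * mpderiv 2 (mpderiv 2 f)
      - mpderiv 1 (mpderiv 2 f) * mpderiv 2 (mpderiv 1 f)) = 0"
    by (simp add: zero_hessian_def det_2 hessian_def)
  then have "pderiv (pderiv p) * (of_nat e * (of_nat (Suc e) * p - ?t * pderiv p)
      - ?t * (of_nat e * pderiv p - ?t * pderiv (pderiv p)))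
      - (of_nat e * pderiv p - ?t * pderiv (pderiv p)) * (of_nat e * pderiv p - ?t * pderiv (pderiv p)) = 0"
    unfolding dehom_diff dehom_mult e dehom_mpderiv_1 f1 f2 d2 p_def[symmetric] .
  \<comment> \<open>What remains has the factor \<open>e\<close>, nonzero in characteristic
    zero.\<close>
  then have "of_nat e * (of_nat (Suc e) * p * pderiv (pderiv p) - of_nat e * pderiv p ^ 2) = 0"
    by algebra
  then show ?thesis
    using assms(3) by simp
qed

section \<open>Polynomial solutions of the differential equation\<close>

lemma order_eq_if_ode:
  fixes p :: "'a::{idom, ring_char_0} poly"
  assumes ode: "of_nat (Suc e) * p * pderiv (pderiv p) = of_nat e * pderiv p ^ 2"
    and "p \<noteq> 0" "poly p r = 0"
  shows "order r p = Suc e"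
proof -
  define l where "l = [:- r, 1:]"
  have "order r p \<noteq> 0"
    using assms by (simp add: order_root)
  then obtain n where n: "order r p = Suc n"
    using not0_implies_Suc by blast
  obtain q where q: "p = l ^ Suc n * q" "\<not> l dvd q"
    using order_decomp[OF \<open>p \<noteq> 0\<close>, of r] n unfolding l_def by auto
  have l: "pderiv l = 1" "l \<noteq> 0" "poly l r = 0"
    by (simp_all add: l_def pderiv_pCons)
  have qr: "poly q r \<noteq> 0"
    using q(2) by (simp add: l_def poly_eq_0_iff_dvd)
  \<comment> \<open>The cofactor of \<open>l ^ n\<close> in \<open>pderiv p\<close>; its value at
    \<open>r\<close> is \<open>of_nat (Suc n) * poly q r\<close>.\<close>
  define u where "u = of_nat (Suc n) * q + l * pderiv q"
  have p1: "pderiv p = l ^ n * u"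
    unfolding q(1) u_def pderiv_mult pderiv_power_Suc l by (simp add: of_nat_poly algebra_simps)
  have lp: "l * pderiv (l ^ n) = of_nat n * l ^ n"
    by (cases n) (simp_all add: pderiv_power_Suc l of_nat_poly algebra_simps del: power_Suc, simp_all)
  \<comment> \<open>The extra factor \<open>l\<close> avoids the exponent \<open>n - 1\<close>, so
    that a simple root (\<open>n = 0\<close>) needs no separate treatment.\<close>
  have p2: "l * pderiv (pderiv p) = l ^ n * (l * pderiv u + of_nat n * u)"
  proof -
    have "l * pderiv (pderiv p) = l ^ n * (l * pderiv u) + u * (l * pderiv (l ^ n))"
      unfolding p1 pderiv_mult by (simp add: algebra_simps)
    then show ?thesis
      unfolding lp by (simp add: algebra_simps)
  qed
  have "(l ^ n * l ^ n * l) * (of_nat (Suc e) * q * (l * pderiv u + of_nat n * u))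
      = (l ^ n * l ^ n * l) * (of_nat e * u ^ 2)"
  proof -
    have "of_nat (Suc e) * p * (l * pderiv (pderiv p)) = l * (of_nat e * pderiv p ^ 2)"
      using ode by algebra
    then show ?thesis
      \<comment> \<open>The order matters: rewriting \<open>p\<close> or \<open>pderiv p\<close>
        earlier would destroy the left-hand sides of the other equations.\<close>
      unfolding p2 unfolding p1 unfolding q(1) power_Suc by (simp add: power2_eq_square mult_ac del: of_nat_Suc)
  qed
  then have "of_nat (Suc e) * q * (l * pderiv u + of_nat n * u) = of_nat e * u ^ 2"
    using l(2) by simp
  \<comment> \<open>Evaluation at \<open>r\<close> kills the terms with \<open>l\<close> and leaves
    the comparison of lowest-order coefficients.\<close>
  then have "poly (of_nat (Suc e) * q * (l * pderiv u + of_nat n * u)) r = poly (of_nat e * u ^ 2) r"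
    by simp
  then have "of_nat (Suc e) * poly q r * (of_nat n * (of_nat (Suc n) * poly q r))
      = of_nat e * (of_nat (Suc n) * poly q r) ^ 2"
    by (simp add: u_def l(3) del: of_nat_Suc)
  then have "(poly q r ^ 2 * of_nat (Suc n)) * of_nat (Suc e * n)
      = (poly q r ^ 2 * of_nat (Suc n)) * (of_nat (e * Suc n) :: 'a)"
    unfolding of_nat_mult by algebra
  then have "(of_nat (Suc e * n) :: 'a) = of_nat (e * Suc n)"
    using qr by (simp del: of_nat_Suc of_nat_mult)
  then have "Suc e * n = e * Suc n"
    by (simp only: of_nat_eq_iff)
  then show ?thesis
    using n by simp
qed

lemma linear_power_if_ode:
  fixes p :: "'a::{alg_closed_field, field_char_0} poly"
  assumes ode: "of_nat (Suc e) * p * pderiv (pderiv p) = of_nat e * pderiv p ^ 2"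
    and deg: "degree p \<le> Suc e"
  shows "\<exists>a b. p = [:b, a:] ^ Suc e"
proof (cases "degree p = 0")
  case True
  then obtain c where c: "p = [:c:]"
    by (rule degree_eq_zeroE)
  \<comment> \<open>The case \<open>p = 0\<close> is included here, with
    \<open>c = 0\<close>.\<close>
  obtain b where "b ^ Suc e = c"
    using nth_root_exists[of "Suc e" c] by auto
  then have "p = [:b, 0:] ^ Suc e"
    using c by (simp add: poly_const_pow del: power_Suc)
  then show ?thesis by blast
next
  case False
  then have "p \<noteq> 0" by auto
  obtain r where r: "poly p r = 0"
    using alg_closed_imp_poly_has_root[of p] False by auto
  have "[:- r, 1:] ^ Suc e dvd p"
    using order_1[of r p] order_eq_if_ode[OF ode \<open>p \<noteq> 0\<close> r] by simp
  then obtain q where q: "p = [:- r, 1:] ^ Suc e * q" ..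
  then have "q \<noteq> 0" using \<open>p \<noteq> 0\<close> by auto
  \<comment> \<open>The degree bound leaves only a constant cofactor, whose root of order
    \<open>Suc e\<close> is absorbed into the linear factor.\<close>
  then have "degree p = Suc e + degree q"
    unfolding q by (subst degree_mult_eq) (simp_all add: degree_linear_power del: power_Suc)
  then have "degree q = 0"
    using deg by simp
  then obtain c where c: "q = [:c:]"
    by (rule degree_eq_zeroE)
  obtain b where b: "b ^ Suc e = c"
    using nth_root_exists[of "Suc e" c] by auto
  have "p = ([:- r, 1:] * [:b:]) ^ Suc e"
    unfolding q c power_mult_distrib poly_const_pow b ..
  then show ?thesis
    by (intro exI[of _ b] exI[of _ "- r * b"]) (simp add: algebra_simps)
qed

section \<open>Return from one variable to binary forms\<close>

theorem theorem5p1: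
  fixes f :: "('a::{alg_closed_field, field_char_0}, 2) mpoly"
    and d :: nat
  assumes "d \<ge> 2"
    and "homogeneous d f"
    and "zero_hessian f"
  shows "\<exists>a1 a2 :: 'a. f = (mconst a1 * mvar 1 + mconst a2 * mvar 2) ^ d"
proof -
  obtain e where d: "d = Suc e" and "e \<noteq> 0"
    using assms(1) by (cases d) auto
  obtain a b where ab: "dehom f = [:b, a:] ^ d"
    using linear_power_if_ode[OF zero_hessian_imp_ode degree_dehom_le] assms(2,3) \<open>e \<noteq> 0\<close>
    unfolding d by blast
  \<comment> \<open>The homogenisation of \<open>[:b, a:]\<close>: the constant coefficient
    \<open>b\<close> goes to the second variable.\<close>
  let ?g = "mconst a * mvar 1 + mconst b * mvar 2 :: ('a, 2) mpoly"
  have "homogeneous 1 ?g"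
    by (intro homogeneous_add)
      (auto simp: homogeneous_2_iff mconst_def mvar_def mult_single lookup_single split: if_splits)
  then have "homogeneous d (?g ^ d)"
    using homogeneous_power[of 1 ?g d] by simp
  moreover have "dehom ?g = [:b, a:]"
    by (simp add: dehom_add mconst_def mvar_def mult_single lookup_single monom_0 monom_Suc)
  then have "dehom f = dehom (?g ^ d)"
    by (simp add: ab dehom_power)
  ultimately have "f = ?g ^ d"
    using assms(2) dehom_inject by blast
  then show ?thesis by blast
qed

end
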